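(* Online SCR (defined in the context) is an online rule that satisfies fixed-rank-wPSC if $\mathcal R^j=\{(r,\dots,r)\in[m]^j:r\in[m]\}$ for every $j$, and satisfies rank-wPSC if $\mathcal R^j=[m]^j$ (all vectors $(r^1,\dots,r^j)$ with $r^1,\dots,r^j\in[m]$) for every $j$.
   Context: Model. Voters $V=[n]$, a set $C$ of $m$ candidates, rounds $T=\{1,\dots,|T|\}$ with $n,m,|T|\ge1$; $|T|$ is the horizon. In each round $j$ each voter $i$ has a strict complete ranking of $C$; $P^j$ denotes the tuple of round-$j$ rankings. For $r\in[m]$, $A_i^j(r)$ is the set of voter $i$'s $r$ most-preferred candidates in round $j$. A group is a nonempty $S\subseteq V$. A rule maps each input to a sequence $W=(w^1,\dots,w^{|T|})\in C^{|T|}$; it is online if each $w^j$ depends only on $P^1,\dots,P^j$ (besides $V,C$) and not on $|T|$. A rule satisfies an axiom if its output does for every input. Axioms. $S$ is solid in round $j$ under a rank vector $\mathbf r$ if $|\bigcap_{i\in S}A_i^j(r^j)|=r^j$, equivalently all members of $S$ have the same set $A_i^j(r^j)$. $W$ satisfies rank-wPSC if, for every $\mathbf r\in[m]^{|T|}$, every positive integer $\ell$, and every group $S$ that is solid under $\mathbf r$ in every round and satisfies $|S|\ge\ell n/|T|$, there are at least $\ell$ rounds $j$ with $w^j\in\bigcup_{i\in S}A_i^j(r^j)$. Fixed-rank-wPSC is the same requirement restricted to constant rank vectors. Online SCR. For a round $j$ and $\mathbf r\in[m]^j$, a claim is a pair $(S,\mathbf r)$ where $S$ is solid under $\mathbf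 r$ in every round $t\le j$; $C^t(S,\mathbf r)$ is the common set $A_i^t(r^t)$, $i\in S$. Let $\mathrm{rep}^{j-1}(S,\mathbf r)=|\{t<j:w^t\in C^t(S,\mathbf r)\}|$ and priority $\pi^{j-1}(S,\mathbf r)=|S|/(\mathrm{rep}^{j-1}(S,\mathbf r)+1)$. In each round $j=1,2,\dots$: for each $\mathbf r\in\mathcal R^j$, partition $V$ into the maximal groups $S$ such that $A_i^t(r^t)=A_{i'}^t(r^t)$ for all $i,i'\in S$ and all $t\le j$, and add each resulting claim $(S,\mathbf r)$ to the collection $\mathsf{Claims}^j$. Set $X\gets C$. While $|X|>1$, choose a claim $(S,\mathbf r)\in\mathsf{Claims}^j$ with $C^j(S,\mathbf r)\subsetneq X$ that maximizes $\pi^{j-1}(S,\mathbf r)$ among all such claims (fixed tie-breaking order), and set $X\gets C^j(S,\mathbf r)$. Let $w^j$ be the unique remaining candidate in $X$. *)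

theory Defs
  imports Complex_Main "HOL-Library.FuncSet" "HOL-Combinatorics.Multiset_Permutations"
begin

text \<open>
  Voters are \<open>{1..n}\<close>, rounds are \<open>{1..T}\<close>, and \<open>m = card C\<close>. A strict complete ranking of
  \<open>C\<close> is a list that enumerates \<open>C\<close> without repetition, most preferred candidate first, so
  the possible rankings are \<open>permutations_of_set C\<close>.
\<close>

type_synonym 'c profile = "nat \<Rightarrow> nat \<Rightarrow> 'c list"  \<comment> \<open>round, voter\<close>
type_synonym 'c outcome = "nat \<Rightarrow> 'c"

text \<open>Arguments of a rule: number of voters, candidates, horizon, profile.\<close>

type_synonym 'c rule = "nat \<Rightarrow> 'c set \<Rightarrow> nat \<Rightarrow> 'c profile \<Rightarrow> 'c outcome"

definition is_input :: "nat \<Rightarrow> 'c set \<Rightarrow> nat \<Rightarrow> 'c profile \<Rightarrow> bool" where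
  "is_input n C T P \<longleftrightarrow>
     1 \<le> n \<and> 1 \<le> T \<and> finite C \<and> 1 \<le> card C \<and>
     P \<in> {1..T} \<rightarrow>\<^sub>E ({1..n} \<rightarrow>\<^sub>E permutations_of_set C)"

definition top_set :: "'c profile \<Rightarrow> nat \<Rightarrow> nat \<Rightarrow> nat \<Rightarrow> 'c set" where
  "top_set P i j r = set (take r (P j i))"

definition is_group :: "nat \<Rightarrow> nat set \<Rightarrow> bool" where
  "is_group n S \<longleftrightarrow> S \<noteq> {} \<and> S \<subseteq> {1..n}"

definition is_rule :: "'c rule \<Rightarrow> bool" where
  "is_rule f \<longleftrightarrow> (\<forall>n C T P. is_input n C T P \<longrightarrow> f n C T P \<in> {1..T} \<rightarrow>\<^sub>E C)"

definition online :: "'c rule \<Rightarrow> bool" where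
  "online f \<longleftrightarrow>
     (\<forall>n C T P T' P' j.
        is_input n C T P \<and> is_input n C T' P' \<and> j \<in> {1..T} \<and> j \<in> {1..T'} \<and>
        (\<forall>t\<in>{1..j}. P t = P' t) \<longrightarrow>
        f n C T P j = f n C T' P' j)"


subsection \<open>Axioms\<close>

definition solid :: "'c profile \<Rightarrow> nat set \<Rightarrow> (nat \<Rightarrow> nat) \<Rightarrow> nat \<Rightarrow> bool" where
  "solid P S r j \<longleftrightarrow> card (\<Inter>i\<in>S. top_set P i j (r j)) = r j"

text \<open>Rank vectors of length \<open>j\<close> with entries in \<open>{1..m}\<close>: all of them, and the constant ones.\<close>

definition rank_vectors :: "nat \<Rightarrow> nat \<Rightarrow> (nat \<Rightarrow> nat) set" where
  "rank_vectors m j = {1..j} \<rightarrow>\<^sub>E {1..m}"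

definition fixed_rank_vectors :: "nat \<Rightarrow> nat \<Rightarrow> (nat \<Rightarrow> nat) set" where
  "fixed_rank_vectors m j = {(\<lambda>t\<in>{1..j}. r) |r. r \<in> {1..m}}"

definition wPSC_for ::
  "(nat \<Rightarrow> nat) set \<Rightarrow> nat \<Rightarrow> nat \<Rightarrow> 'c profile \<Rightarrow> 'c outcome \<Rightarrow> bool" where
  "wPSC_for Rs n T P w \<longleftrightarrow>
     (\<forall>r\<in>Rs. \<forall>l::nat. \<forall>S.
        1 \<le> l \<and> is_group n S \<and> (\<forall>j\<in>{1..T}. solid P S r j) \<and>
        real (card S) \<ge> real l * real n / real T \<longrightarrow>
        l \<le> card {j\<in>{1..T}. w j \<in> (\<Union>i\<in>S. top_set P i j (r j))})"

definition rank_wPSC :: "nat \<Rightarrow> 'c set \<Rightarrow> nat \<Rightarrow> 'c profile \<Rightarrow> 'c outcome \<Rightarrow> bool" where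
  "rank_wPSC n C T P w \<longleftrightarrow> wPSC_for (rank_vectors (card C) T) n T P w"

definition fixed_rank_wPSC :: "nat \<Rightarrow> 'c set \<Rightarrow> nat \<Rightarrow> 'c profile \<Rightarrow> 'c outcome \<Rightarrow> bool" where
  "fixed_rank_wPSC n C T P w \<longleftrightarrow> wPSC_for (fixed_rank_vectors (card C) T) n T P w"

definition satisfies ::
  "'c rule \<Rightarrow> (nat \<Rightarrow> 'c set \<Rightarrow> nat \<Rightarrow> 'c profile \<Rightarrow> 'c outcome \<Rightarrow> bool) \<Rightarrow> bool" where
  "satisfies f ax \<longleftrightarrow> (\<forall>n C T P. is_input n C T P \<longrightarrow> ax n C T P (f n C T P))"


subsection \<open>Online SCR\<close>

type_synonym claim = "nat set \<times> (nat \<Rightarrow> nat)"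

text \<open>\<open>R m j\<close> is the set of rank vectors considered in round \<open>j\<close> when there are \<open>m\<close> candidates.\<close>

type_synonym rank_family = "nat \<Rightarrow> nat \<Rightarrow> (nat \<Rightarrow> nat) set"

text \<open>
  Ties in round \<open>j\<close> are broken by a linear order \<open>tb n C j\<close> on claims. It is fixed in
  advance: it may vary with the voters, the candidates and the round, but not with the
  rankings or the horizon.
\<close>

type_synonym 'c tie_break = "nat \<Rightarrow> 'c set \<Rightarrow> nat \<Rightarrow> claim rel"

definition agree :: "'c profile \<Rightarrow> nat \<Rightarrow> (nat \<Rightarrow> nat) \<Rightarrow> nat set \<Rightarrow> bool" where
  "agree P j r S \<longleftrightarrow>
     (\<forall>i\<in>S. \<forall>i'\<in>S. \<forall>t\<in>{1..j}. top_set P i t (r t) = top_set P i' t (r t))"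

definition claims :: "rank_family \<Rightarrow> nat \<Rightarrow> 'c set \<Rightarrow> 'c profile \<Rightarrow> nat \<Rightarrow> claim set" where
  "claims R n C P j =
     {(S, r). r \<in> R (card C) j \<and> is_group n S \<and> agree P j r S \<and>
        (\<forall>S'. is_group n S' \<and> agree P j r S' \<and> S \<subseteq> S' \<longrightarrow> S' = S)}"

text \<open>For a claim, the sets intersected here all coincide.\<close>

definition common_set :: "'c profile \<Rightarrow> nat \<Rightarrow> claim \<Rightarrow> 'c set" where
  "common_set P t c = (\<Inter>i\<in>fst c. top_set P i t (snd c t))"

text \<open>\<open>rep P w j\<close> and \<open>priority P w j\<close> take into account the rounds before round \<open>j\<close> only.\<close>

definition rep :: "'c profile \<Rightarrow> 'c outcome \<Rightarrow> nat \<Rightarrow> claim \<Rightarrow> nat" where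
  "rep P w j c = card {t\<in>{1..<j}. w t \<in> common_set P t c}"

definition priority :: "'c profile \<Rightarrow> 'c outcome \<Rightarrow> nat \<Rightarrow> claim \<Rightarrow> real" where
  "priority P w j c = real (card (fst c)) / real (rep P w j c + 1)"

definition max_claim ::
  "rank_family \<Rightarrow> nat \<Rightarrow> 'c set \<Rightarrow> 'c profile \<Rightarrow> 'c outcome \<Rightarrow> nat \<Rightarrow> 'c set \<Rightarrow> claim \<Rightarrow> bool" where
  "max_claim R n C P w j X =
     is_arg_max (priority P w j) (\<lambda>c. c \<in> claims R n C P j \<and> common_set P j c \<subset> X)"

definition chosen_claim ::
  "rank_family \<Rightarrow> 'c tie_break \<Rightarrow> nat \<Rightarrow> 'c set \<Rightarrow> 'c profile \<Rightarrow> 'c outcome \<Rightarrow> nat \<Rightarrow> 'c set \<Rightarrow> claim \<Rightarrow> bool"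
  where
  "chosen_claim R tb n C P w j X c \<longleftrightarrow>
     max_claim R n C P w j X c \<and> (\<forall>c'. max_claim R n C P w j X c' \<longrightarrow> (c, c') \<in> tb n C j)"

text \<open>
  The values taken by \<open>X\<close> during the loop of round \<open>j\<close>, where \<open>w\<close> holds the winners of
  the earlier rounds.
\<close>

inductive loop_value ::
  "rank_family \<Rightarrow> 'c tie_break \<Rightarrow> nat \<Rightarrow> 'c set \<Rightarrow> 'c profile \<Rightarrow> 'c outcome \<Rightarrow> nat \<Rightarrow> 'c set \<Rightarrow> bool"
  for R tb n C P w j where
  init: "loop_value R tb n C P w j C"
| step: "loop_value R tb n C P w j (common_set P j c)"
    if "loop_value R tb n C P w j X" "card X > 1" "chosen_claim R tb n C P w j X c"

definition round_winner ::
  "rank_family \<Rightarrow> 'c tie_break \<Rightarrow> nat \<Rightarrow> 'c set \<Rightarrow> 'c profile \<Rightarrow> 'c outcome \<Rightarrow> nat \<Rightarrow> 'c" where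
  "round_winner R tb n C P w j = (THE x. loop_value R tb n C P w j {x})"

text \<open>The winners after \<open>j\<close> rounds; values outside \<open>{1..j}\<close> are irrelevant.\<close>

primrec winners ::
  "rank_family \<Rightarrow> 'c tie_break \<Rightarrow> nat \<Rightarrow> 'c set \<Rightarrow> 'c profile \<Rightarrow> nat \<Rightarrow> 'c outcome" where
  "winners R tb n C P 0 = (\<lambda>_. undefined)"
| "winners R tb n C P (Suc j) =
     (winners R tb n C P j)(Suc j := round_winner R tb n C P (winners R tb n C P j) (Suc j))"

definition online_SCR :: "rank_family \<Rightarrow> 'c tie_break \<Rightarrow> 'c rule" where
  "online_SCR R tb n C T P = (\<lambda>j\<in>{1..T}. winners R tb n C P T j)"

text \<open>
  In every round of every input the loop ends with exactly one remaining candidate, so the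
  definite description in \<open>round_winner\<close> is meaningful.
\<close>

definition SCR_well_defined :: "rank_family \<Rightarrow> 'c tie_break \<Rightarrow> bool" where
  "SCR_well_defined R tb \<longleftrightarrow>
     (\<forall>n C T P. is_input n C T P \<longrightarrow>
        (\<forall>j\<in>{1..T}. \<exists>!x. loop_value R tb n C P (online_SCR R tb n C T P) j {x}))"

end

theory Submission imports Defs begin

text \<open>
  Let \<open>q = n / T\<close> and suppose a group \<open>S\<close> with \<open>|S| \<ge> l q\<close> is represented in fewer than \<open>l\<close> rounds.
  Then in every round its claim has priority at least \<open>q\<close>. In each round charge \<open>q\<close> to the claim
  that produced the smallest value of \<open>X\<close> coming from a claim of priority at least \<open>q\<close>. If the
  group charged in a round meets a group \<open>S'\<close> whose priority is still at least \<open>q\<close>, then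
  the winner lies in the common set of \<open>S'\<close>: the two common sets are nested, and a strictly smaller
  one for \<open>S'\<close> would have continued the loop at priority at least \<open>q\<close>. So a group with \<open>k\<close>
  represented rounds has paid at most \<open>k q\<close>, and a group charged in the current round can afford
  \<open>q\<close> out of one unit per voter. After \<open>T\<close> rounds all \<open>n\<close> units are spent, yet \<open>S\<close> still
  owns at least \<open>q\<close>.
\<close>

section \<open>Charging groups against unit budgets\<close>

text \<open>Read \<open>y i\<close> as the amount that \<open>i\<close> has spent from a budget of
  one unit, where each group \<open>G t\<close> pays \<open>q\<close> in total. The bound for all
  \<open>S\<close> is carried through the induction because, taken at the next group, it shows that
  this group can still afford \<open>q\<close>.\<close>

lemma charging:
  fixes G :: "nat \<Rightarrow> 'a set" and q :: real
  assumes "finite V" "q > 0"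
    and "\<And>t. t \<in> {1..T} \<Longrightarrow> G t \<subseteq> V"
    and "\<And>t. t \<in> {1..T} \<Longrightarrow>
      q * (real (card {s\<in>{1..<t}. G s \<inter> G t \<noteq> {}}) + 1) \<le> real (card (G t))"
  shows "\<exists>y. (\<forall>i\<in>V. y i \<le> 1) \<and> sum y V = real T * q \<and>
    (\<forall>S\<subseteq>V. sum y S \<le> q * real (card {t\<in>{1..T}. G t \<inter> S \<noteq> {}}))"
  using assms(3,4)
proof (induction T)
  case 0
  then show ?case by (intro exI[of _ "\<lambda>_. 0"]) simp
next
  case (Suc T)
  obtain y where y1: "\<forall>i\<in>V. y i \<le> 1" and yV: "sum y V = real T * q"
    and yS: "\<forall>S\<subseteq>V. sum y S \<le> q * real (card {t\<in>{1..T}. G t \<inter> S \<noteq> {}})"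
  proof -
    have "t \<in> {1..Suc T}" if "t \<in> {1..T}" for t using that by simp
    then show ?thesis using Suc.IH[OF Suc.prems] that by blast
  qed
  define A where "A = G (Suc T)"
  define \<rho> where "\<rho> = (\<Sum>i\<in>A. 1 - y i)"
  have AV: "A \<subseteq> V" using Suc.prems(1)[of "Suc T"] by (simp add: A_def)
  have fA: "finite A" using AV assms(1) finite_subset by blast
  \<comment> \<open>The number of earlier groups that meet \<open>A\<close> bounds what
    \<open>A\<close> has spent, so at least \<open>q\<close> of its \<open>card A\<close> units are
    left.\<close>
  have "{s\<in>{1..<Suc T}. G s \<inter> A \<noteq> {}} = {s\<in>{1..T}. G s \<inter> A \<noteq> {}}" by auto
  then have "q * (real (card {s\<in>{1..T}. G s \<inter> A \<noteq> {}}) + 1) \<le> real (card A)"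
    using Suc.prems(2)[of "Suc T"] by (simp add: A_def)
  moreover have "\<rho> = real (card A) - sum y A" by (simp add: \<rho>_def sum_subtractf)
  moreover have "sum y A \<le> q * real (card {s\<in>{1..T}. G s \<inter> A \<noteq> {}})" using yS AV by blast
  ultimately have q\<rho>: "q \<le> \<rho>" by (simp add: algebra_simps)
  \<comment> \<open>Members of \<open>A\<close> pay in proportion to what they have left: the total
    is \<open>q\<close> and, as \<open>q / \<rho>\<close> is at most one, nobody overspends.\<close>
  define d where "d i = (if i \<in> A then q / \<rho> * (1 - y i) else 0)" for i
  have frac: "0 \<le> q / \<rho>" "q / \<rho> \<le> 1" using q\<rho> assms(2) by (auto simp: field_simps)
  have d_sum: "sum d S = q / \<rho> * (\<Sum>i\<in>S \<inter> A. 1 - y i)" if "S \<subseteq> V" for S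
  proof -
    have "finite S" using that assms(1) finite_subset by blast
    then show ?thesis unfolding d_def sum_distrib_left by (simp only: sum.inter_restrict)
  qed
  have d_le: "sum d S \<le> (if A \<inter> S \<noteq> {} then q else 0)" if "S \<subseteq> V" for S
  proof -
    have "(\<Sum>i\<in>S \<inter> A. 1 - y i) \<le> \<rho>"
      unfolding \<rho>_def by (rule sum_mono2) (use fA AV y1 in auto)
    then have "q / \<rho> * (\<Sum>i\<in>S \<inter> A. 1 - y i) \<le> q / \<rho> * \<rho>"
      using frac by (intro mult_left_mono) auto
    then have "sum d S \<le> q" using d_sum[OF that] q\<rho> assms(2) by simp
    moreover have "sum d S = 0" if "A \<inter> S = {}" using d_sum[OF \<open>S \<subseteq> V\<close>] that
      by (simp add: Int_commute)
    ultimately show ?thesis by simp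
  qed
  have "\<forall>i\<in>V. y i + d i \<le> 1"
  proof
    fix i assume "i \<in> V"
    then have "q / \<rho> * (1 - y i) \<le> 1 * (1 - y i)"
      using frac y1 by (intro mult_right_mono) auto
    then show "y i + d i \<le> 1" using y1 \<open>i \<in> V\<close> by (auto simp: d_def)
  qed
  moreover have "(\<Sum>i\<in>V. y i + d i) = real (Suc T) * q"
  proof -
    have "V \<inter> A = A" using AV by blast
    then have "sum d V = q" using d_sum[of V] q\<rho> assms(2) by (simp flip: \<rho>_def)
    then show ?thesis by (simp add: sum.distrib yV algebra_simps)
  qed
  moreover have "(\<Sum>i\<in>S. y i + d i) \<le> q * real (card {t\<in>{1..Suc T}. G t \<inter> S \<noteq> {}})"
    if S: "S \<subseteq> V" for S
  proof -
    let ?B = "{t\<in>{1..T}. G t \<inter> S \<noteq> {}}"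
    have "{t\<in>{1..Suc T}. G t \<inter> S \<noteq> {}} = (if A \<inter> S \<noteq> {} then insert (Suc T) ?B else ?B)"
      by (auto simp: A_def le_Suc_eq)
    then have "q * real (card {t\<in>{1..Suc T}. G t \<inter> S \<noteq> {}}) =
        q * real (card ?B) + (if A \<inter> S \<noteq> {} then q else 0)"
      by (simp add: algebra_simps)
    moreover have "sum y S \<le> q * real (card ?B)" using yS S by blast
    ultimately show ?thesis using d_le[OF S] by (simp add: sum.distrib)
  qed
  ultimately show ?case by (intro exI[of _ "\<lambda>i. y i + d i"]) blast
qed

text \<open>Elements outside \<open>S\<close> spend at most one unit each, while \<open>S\<close>
  keeps at least \<open>q\<close>; so the total spent falls short of \<open>card V\<close> by at
  least \<open>q\<close>.\<close>

lemma charging_leftover: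
  fixes G :: "nat \<Rightarrow> 'a set" and q :: real
  assumes "finite V" "q > 0"
    and "\<And>t. t \<in> {1..T} \<Longrightarrow> G t \<subseteq> V"
    and "\<And>t. t \<in> {1..T} \<Longrightarrow>
      q * (real (card {s\<in>{1..<t}. G s \<inter> G t \<noteq> {}}) + 1) \<le> real (card (G t))"
    and "S \<subseteq> V" "q * (real (card {t\<in>{1..T}. G t \<inter> S \<noteq> {}}) + 1) \<le> real (card S)"
  shows "real T * q + q \<le> real (card V)"
proof -
  obtain y where y1: "\<forall>i\<in>V. y i \<le> 1" and yV: "sum y V = real T * q"
    and yS: "\<forall>S\<subseteq>V. sum y S \<le> q * real (card {t\<in>{1..T}. G t \<inter> S \<noteq> {}})"
    using charging[of V q T G, OF assms(1-4)] by blast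
  have "finite S" using assms(1,5) finite_subset by blast
  have "sum y V = sum y S + sum y (V - S)"
    using sum.subset_diff[OF assms(5,1), of y] by simp
  moreover have "sum y (V - S) \<le> (\<Sum>i\<in>V - S. 1)" by (rule sum_mono) (use y1 in auto)
  moreover have "real (card (V - S)) = real (card V) - real (card S)"
    using assms(1,5) \<open>finite S\<close> by (simp add: card_Diff_subset card_mono of_nat_diff)
  moreover have "sum y S \<le> q * real (card {t\<in>{1..T}. G t \<inter> S \<noteq> {}})" using yS assms(5) by blast
  ultimately show ?thesis using assms(6) yV by (simp add: algebra_simps)
qed

section \<open>Linear orders, agreeing groups and top sets\<close>

text \<open>Makes tie-breaking effective: among finitely many claims of maximal priority, one
  precedes all the others.\<close>

lemma linear_order_finite_least:
  assumes "linear_order r" "finite A" "A \<noteq> {}"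
  shows "\<exists>a\<in>A. \<forall>b\<in>A. (a, b) \<in> r"
  using assms(2,3)
proof (induction A rule: finite_ne_induct)
  case (singleton x)
  then show ?case using assms(1)
    by (auto simp: order_on_defs dest: refl_onD)
next
  case (insert x F)
  then obtain a where a: "a \<in> F" "\<forall>b\<in>F. (a, b) \<in> r" by blast
  have "(x, x) \<in> r" "trans r" "(x, a) \<in> r \<or> (a, x) \<in> r"
    using assms(1) unfolding order_on_defs total_on_def refl_on_def by auto (metis UNIV_I)
  then show ?case using a by (blast dest: transD)
qed

lemma agree_antimono: "agree P k r S \<Longrightarrow> j \<le> k \<Longrightarrow> agree P j r S"
  unfolding agree_def by (meson atLeastatMost_subset_iff order_refl subsetD)

lemma common_set_eq:
  assumes "agree P j r S" "i \<in> S" "t \<in> {1..j}"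
  shows "common_set P t (S, r) = top_set P i t (r t)"
proof -
  have "top_set P i' t (r t) = top_set P i t (r t)" if "i' \<in> S" for i'
    using assms that unfolding agree_def by blast
  then show ?thesis unfolding common_set_def fst_conv snd_conv
    using assms(2) by (intro INF_eq_const) blast+
qed

lemma top_set_mono: "r \<le> r' \<Longrightarrow> top_set P i j r \<subseteq> top_set P i j r'"
  unfolding top_set_def by (rule set_take_subset_set_take)

section \<open>Dependence on past rounds and the online property\<close>

text \<open>One direction suffices: the hypotheses are symmetric, so swapping the two sides gives
  the converse.\<close>

lemma loop_value_mono:
  assumes "loop_value R tb n C P w j X" "chosen_claim R tb n C P w j = chosen_claim R tb n C P' w' j"
    and "common_set P j = common_set P' j"
  shows "loop_value R tb n C P' w' j X"
  using assms(1) by induction (auto simp: assms(2,3) intro: loop_value.intros)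

text \<open>Claims of round \<open>j\<close> see the rankings up to \<open>j\<close>, and priorities
  see only the winners before \<open>j\<close>. This serves both to replace partial outcomes by the
  final one and to compare two inputs.\<close>

lemma loop_value_cong:
  assumes "\<And>t. t \<in> {1..j} \<Longrightarrow> P t = P' t" "\<And>t. t \<in> {1..<j} \<Longrightarrow> w t = w' t" "1 \<le> j"
  shows "loop_value R tb n C P w j = loop_value R tb n C P' w' j"
proof -
  have top: "top_set P i t k = top_set P' i t k" if "t \<in> {1..j}" for i t k
    using assms(1)[OF that] by (simp add: top_set_def)
  have common: "common_set P t c = common_set P' t c" if "t \<in> {1..j}" for t c
    using top[OF that] by (simp add: common_set_def)
  have "agree P j = agree P' j" using top by (simp add: agree_def fun_eq_iff)
  then have cl: "claims R n C P j = claims R n C P' j" by (simp add: claims_def)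
  have "rep P w j c = rep P' w' j c" for c
  proof -
    have "w t \<in> common_set P t c \<longleftrightarrow> w' t \<in> common_set P' t c" if "t \<in> {1..<j}" for t
      using common[of t c] assms(2)[OF that] that by simp
    then show ?thesis unfolding rep_def by (intro arg_cong[of _ _ card]) blast
  qed
  then have pr: "priority P w j = priority P' w' j" by (simp add: priority_def fun_eq_iff)
  have cj: "common_set P j = common_set P' j" using common assms(3) by auto
  have ch: "chosen_claim R tb n C P w j = chosen_claim R tb n C P' w' j"
    by (simp add: chosen_claim_def max_claim_def cl pr cj fun_eq_iff)
  show ?thesis
    using loop_value_mono[OF _ ch cj] loop_value_mono[OF _ ch[symmetric] cj[symmetric]]
    by (auto simp: fun_eq_iff)
qed

lemma winners_stable: "j \<le> k \<Longrightarrow> winners R tb n C P k j = winners R tb n C P j j"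
  by (induction k) (auto simp: le_Suc_eq)

text \<open>Turns the recursion over rounds into a fixed-point equation for the final outcome, since
  later winners do not influence the loop of round \<open>j\<close>.\<close>

lemma online_SCR_round_winner:
  assumes "j \<in> {1..T}"
  shows "online_SCR R tb n C T P j = round_winner R tb n C P (online_SCR R tb n C T P) j"
proof -
  obtain k where k: "j = Suc k" using assms by (cases j) auto
  have "online_SCR R tb n C T P j = round_winner R tb n C P (winners R tb n C P k) j"
    using assms winners_stable[of j T] k by (simp add: online_SCR_def)
  also have "\<dots> = round_winner R tb n C P (online_SCR R tb n C T P) j"
  proof -
    have "winners R tb n C P k t = online_SCR R tb n C T P t" if "t \<in> {1..<j}" for t
      using that assms k winners_stable[of t k R tb n C P] winners_stable[of t T R tb n C P]
      by (simp add: online_SCR_def)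
    then show ?thesis unfolding round_winner_def
      using loop_value_cong[of j P P "winners R tb n C P k" "online_SCR R tb n C T P"] assms
      by simp
  qed
  finally show ?thesis .
qed

lemma winners_cong:
  "(\<And>t. t \<in> {1..j} \<Longrightarrow> P t = P' t) \<Longrightarrow> winners R tb n C P j = winners R tb n C P' j"
proof (induction j)
  case (Suc j)
  then have "winners R tb n C P j = winners R tb n C P' j" by simp
  moreover have "loop_value R tb n C P w (Suc j) = loop_value R tb n C P' w (Suc j)" for w
    by (rule loop_value_cong) (use Suc.prems in auto)
  ultimately show ?case by (simp add: round_winner_def)
qed simp

text \<open>Both sides equal the winner of round \<open>j\<close> computed after exactly
  \<open>j\<close> rounds, where no horizon occurs.\<close>

lemma online_online_SCR:
  fixes tb :: "'c tie_break"
  shows "online (online_SCR R tb)"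
  unfolding online_def
proof (intro allI impI, elim conjE)
  fix n T T' j and C :: "'c set" and P P' :: "'c profile"
  assume j: "j \<in> {1..T}" "j \<in> {1..T'}" and eq: "\<forall>t\<in>{1..j}. P t = P' t"
  show "online_SCR R tb n C T P j = online_SCR R tb n C T' P' j"
    using j winners_stable[of j T R tb n C P] winners_stable[of j T' R tb n C P']
      winners_cong[of j P P' R tb n C] eq
    by (simp add: online_SCR_def)
qed

section \<open>Claims for an abstract family of rank vectors\<close>

text \<open>Collects what both families share. The constant vector one lets the loop shrink to a
  single candidate; closure under prefixes lets a vector for the whole horizon produce claims in
  every round.\<close>

locale SCR =
  fixes R :: rank_family and tb :: "'c tie_break" and n :: nat and C :: "'c set"
    and T :: nat and P :: "'c profile"
  assumes R_subset: "R m j \<subseteq> rank_vectors m j"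
    and R_one: "1 \<le> m \<Longrightarrow> (\<lambda>t\<in>{1..j}. 1) \<in> R m j"
    and R_restrict: "r \<in> R m j \<Longrightarrow> s \<le> j \<Longrightarrow> restrict r {1..s} \<in> R m s"
    and tb: "linear_order (tb n C j)"
    and input: "is_input n C T P"
begin

lemma finite_C: "finite C" and card_C: "1 \<le> card C" and n_pos: "1 \<le> n" and T_pos: "1 \<le> T"
  using input by (auto simp: is_input_def)

lemma card_top_set:
  assumes "i \<in> {1..n}" "j \<in> {1..T}" "k \<le> card C"
  shows "card (top_set P i j k) = k" and "top_set P i j k \<subseteq> C"
proof -
  have "P \<in> {1..T} \<rightarrow>\<^sub>E ({1..n} \<rightarrow>\<^sub>E permutations_of_set C)" using input by (simp add: is_input_def)
  then have p: "P j i \<in> permutations_of_set C" using assms by (meson PiE_mem)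
  then have "length (P j i) = card C" "distinct (P j i)"
    using finite_C by (auto simp: permutations_of_set_def distinct_card)
  then show "card (top_set P i j k) = k" using assms(3)
    by (simp add: top_set_def distinct_card)
  show "top_set P i j k \<subseteq> C" using p set_take_subset[of k "P j i"]
    by (simp add: top_set_def permutations_of_set_def)
qed

lemma rank_bounds: "r \<in> R (card C) j \<Longrightarrow> t \<in> {1..j} \<Longrightarrow> 1 \<le> r t \<and> r t \<le> card C"
  using R_subset[of "card C" j] by (auto simp: rank_vectors_def PiE_iff)

lemma claimsD:
  assumes "(S, r) \<in> claims R n C P j"
  shows "r \<in> R (card C) j" "S \<noteq> {}" "S \<subseteq> {1..n}" "agree P j r S"
  using assms by (auto simp: claims_def is_group_def)

lemma common_set_claim:
  assumes "c \<in> claims R n C P j" "j \<in> {1..T}"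
  shows "common_set P j c \<subseteq> C" "common_set P j c \<noteq> {}"
proof -
  obtain S r where c: "c = (S, r)" by force
  note D = claimsD[OF assms(1)[unfolded c]]
  obtain i where i: "i \<in> S" using D by blast
  have eq: "common_set P j c = top_set P i j (r j)"
    using common_set_eq[OF D(4) i] assms(2) c by simp
  have b: "1 \<le> r j \<and> r j \<le> card C" using rank_bounds[OF D(1)] assms(2) by simp
  then show "common_set P j c \<subseteq> C" "common_set P j c \<noteq> {}"
    using eq card_top_set[of i j "r j"] assms(2) D(3) i by fastforce+
qed

lemma finite_claims: "finite (claims R n C P j)"
proof -
  have "claims R n C P j \<subseteq> Pow {1..n} \<times> rank_vectors (card C) j"
    using claimsD(1,3) R_subset by fast
  moreover have "finite (rank_vectors (card C) j)" unfolding rank_vectors_def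
    by (intro finite_PiE) auto
  ultimately show ?thesis by (meson finite_Pow_iff finite_SigmaI finite_atLeastAtMost finite_subset)
qed

text \<open>Leads from arbitrary agreeing groups to the maximal ones in \<open>claims\<close>:
  adding every voter with the same top sets up to round \<open>j\<close> leaves the common sets
  unchanged. The vector is cut to \<open>{1..j}\<close> to match the length used in round
  \<open>j\<close>.\<close>

lemma extend_to_claim:
  assumes "S \<noteq> {}" "S \<subseteq> {1..n}" "restrict r {1..j} \<in> R (card C) j" "agree P j r S"
  shows "\<exists>S'. S \<subseteq> S' \<and> (S', restrict r {1..j}) \<in> claims R n C P j \<and>
    (\<forall>t\<in>{1..j}. common_set P t (S', restrict r {1..j}) = common_set P t (S, r))"
proof -
  let ?r = "restrict r {1..j}"
  obtain i0 where i0: "i0 \<in> S" using assms(1) by blast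
  define S' where "S' = {i\<in>{1..n}. \<forall>t\<in>{1..j}. top_set P i t (r t) = top_set P i0 t (r t)}"
  have sub: "S \<subseteq> S'" using assms(2,4) i0 unfolding S'_def agree_def by blast
  have ag: "agree P j ?r S'" by (simp add: agree_def S'_def)
  have "S'' = S'" if "is_group n S''" "agree P j ?r S''" "S' \<subseteq> S''" for S''
  proof
    have "i0 \<in> S''" using i0 sub that(3) by blast
    then have "top_set P i t (r t) = top_set P i0 t (r t)" if "i \<in> S''" "t \<in> {1..j}" for i t
      using \<open>agree P j ?r S''\<close> that unfolding agree_def by (metis restrict_apply')
    then show "S'' \<subseteq> S'" using that(1) unfolding S'_def is_group_def by blast
  qed (rule that(3))
  then have "(S', ?r) \<in> claims R n C P j"
    using assms(3) ag sub i0 by (auto simp: claims_def is_group_def S'_def)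
  moreover have "common_set P t (S', ?r) = common_set P t (S, r)" if "t \<in> {1..j}" for t
    using common_set_eq[OF ag, of i0 t] common_set_eq[OF assms(4) i0 that] sub i0 that by auto
  ultimately show ?thesis using sub by blast
qed

section \<open>The loop of a single round\<close>

text \<open>Recasts the loop as reachability, so that confluence of single-valued relations applies:
  of two loop values, one is reached from the other.\<close>

definition loop_step :: "'c outcome \<Rightarrow> nat \<Rightarrow> 'c set rel" where
  "loop_step w j =
     {(X, common_set P j c) |X c. card X > 1 \<and> chosen_claim R tb n C P w j X c}"

lemma loop_value_iff: "loop_value R tb n C P w j X \<longleftrightarrow> (C, X) \<in> (loop_step w j)\<^sup>*"
proof
  show "(C, X) \<in> (loop_step w j)\<^sup>*" if "loop_value R tb n C P w j X"
    using that
  proof induction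
    case (step X c)
    then have "(X, common_set P j c) \<in> loop_step w j" unfolding loop_step_def by blast
    then show ?case using step.IH by (rule rtrancl_into_rtrancl[rotated])
  qed simp
  show "loop_value R tb n C P w j X" if "(C, X) \<in> (loop_step w j)\<^sup>*"
    using that by induction (auto simp: loop_step_def intro: loop_value.intros)
qed

lemma chosen_claimD:
  assumes "chosen_claim R tb n C P w j X c"
  shows "c \<in> claims R n C P j" "common_set P j c \<subset> X"
    "c' \<in> claims R n C P j \<Longrightarrow> common_set P j c' \<subset> X \<Longrightarrow> priority P w j c' \<le> priority P w j c"
  using assms unfolding chosen_claim_def max_claim_def is_arg_max_linorder by blast+

lemma chosen_claim_unique:
  assumes "chosen_claim R tb n C P w j X c" "chosen_claim R tb n C P w j X c'"
  shows "c = c'"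
  using assms tb[of j] unfolding chosen_claim_def order_on_defs by (meson antisymD)

lemma chosen_claim_exists:
  assumes "c \<in> claims R n C P j" "common_set P j c \<subset> X"
  shows "\<exists>c. chosen_claim R tb n C P w j X c"
proof -
  let ?A = "{c \<in> claims R n C P j. common_set P j c \<subset> X}"
  let ?M = "{c. max_claim R n C P w j X c}"
  have fA: "finite ?A" using finite_claims by simp
  have "finite ?M" using fA by (rule rev_finite_subset) (auto simp: max_claim_def is_arg_max_def)
  moreover have "?M \<noteq> {}"
  proof -
    have "Max (priority P w j ` ?A) \<in> priority P w j ` ?A"
      using fA assms by (intro Max_in) blast+
    then obtain c0 where "c0 \<in> ?A" "priority P w j c0 = Max (priority P w j ` ?A)" by force
    moreover have "priority P w j c' \<le> Max (priority P w j ` ?A)" if "c' \<in> ?A" for c'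
      using fA that by (intro Max_ge) auto
    ultimately have "max_claim R n C P w j X c0"
      unfolding max_claim_def is_arg_max_linorder by auto
    then show ?thesis by blast
  qed
  ultimately show ?thesis
    using linear_order_finite_least[OF tb[of j], of ?M] unfolding chosen_claim_def by blast
qed

lemma single_valued_loop_step: "single_valued (loop_step w j)"
  by (rule single_valuedI) (auto simp: loop_step_def dest: chosen_claim_unique)

lemma loop_step_decreasing: "(X, Y) \<in> (loop_step w j)\<^sup>* \<Longrightarrow> Y \<subseteq> X"
  by (induction rule: rtrancl_induct) (auto simp: loop_step_def dest: chosen_claimD)

lemma loop_value_props:
  assumes "loop_value R tb n C P w j X" "j \<in> {1..T}"
  shows "X \<subseteq> C" "X \<noteq> {}"
proof -
  have "X \<subseteq> C \<and> X \<noteq> {}"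
    using assms(1)
  proof cases
    case init
    then show ?thesis using card_C by auto
  next
    case (step Y c)
    then show ?thesis using common_set_claim[OF chosen_claimD(1)[OF step(4)] assms(2)] by blast
  qed
  then show "X \<subseteq> C" "X \<noteq> {}" by auto
qed

text \<open>Every loop value contains the favourite of some voter, being \<open>C\<close> or a top
  set of rank at least one. The claim of that voter under the constant vector one has a one-element
  common set inside \<open>X\<close>.\<close>

lemma loop_continues:
  assumes "loop_value R tb n C P w j X" "j \<in> {1..T}" "card X > 1"
  shows "\<exists>c. chosen_claim R tb n C P w j X c"
proof -
  have "\<exists>i\<in>{1..n}. top_set P i j 1 \<subseteq> X"
    using assms(1)
  proof cases
    case init
    then show ?thesis using card_top_set(2)[of 1 j 1] n_pos assms(2) card_C
      by (intro bexI[of _ 1]) auto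
  next
    case (step Y c)
    obtain S r where c: "c = (S, r)" by force
    note D = claimsD[OF chosen_claimD(1)[OF step(4)[unfolded c]]]
    obtain i where i: "i \<in> S" using D by blast
    have "X = top_set P i j (r j)"
      using common_set_eq[OF D(4) i, of j] assms(2) c step(1) by simp
    moreover have "1 \<le> r j" using rank_bounds[OF D(1)] assms(2) by simp
    ultimately have "top_set P i j 1 \<subseteq> X" using top_set_mono[of 1 "r j" P i j] by simp
    then show ?thesis using i D(3) by blast
  qed
  then obtain i where i: "i \<in> {1..n}" "top_set P i j 1 \<subseteq> X" by blast
  let ?r = "\<lambda>t\<in>{1..j}. (1::nat)"
  have ag: "agree P j ?r {i}" by (simp add: agree_def)
  have i': "{i} \<subseteq> {1..n}" using i(1) by simp
  have R1: "restrict ?r {1..j} \<in> R (card C) j" using R_one[OF card_C, of j] by simp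
  obtain S' where S': "(S', restrict ?r {1..j}) \<in> claims R n C P j"
    "common_set P j (S', restrict ?r {1..j}) = common_set P j ({i}, ?r)"
  proof -
    have "j \<in> {1..j}" using assms(2) by simp
    with extend_to_claim[OF insert_not_empty i' R1 ag] that show thesis by metis
  qed
  have "common_set P j (S', restrict ?r {1..j}) = top_set P i j 1"
    using S'(2) common_set_eq[OF ag, of i j] assms(2) by simp
  moreover have "card (top_set P i j 1) = 1"
    using card_top_set(1)[OF i(1) assms(2)] card_C by simp
  ultimately have "common_set P j (S', restrict ?r {1..j}) \<subset> X" using i(2) assms(3)
    by (metis less_irrefl psubsetI)
  then show ?thesis using chosen_claim_exists[OF S'(1)] by blast
qed

text \<open>A loop value of least size cannot be continued, hence is a singleton. Two singleton
  values lie on the same decreasing run, hence coincide.\<close>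

lemma loop_terminates:
  assumes "j \<in> {1..T}"
  shows "\<exists>!x. loop_value R tb n C P w j {x}"
proof (rule ex_ex1I)
  obtain X where X: "loop_value R tb n C P w j X"
    and min: "\<And>Y. loop_value R tb n C P w j Y \<Longrightarrow> card X \<le> card Y"
    using ex_has_least_nat[of "loop_value R tb n C P w j" C card] loop_value.init by metis
  have X': "finite X" "X \<noteq> {}" using loop_value_props[OF X assms] finite_subset[OF _ finite_C] by blast+
  have "\<not> card X > 1"
  proof
    assume "card X > 1"
    then obtain c where c: "chosen_claim R tb n C P w j X c" using loop_continues[OF X assms] by blast
    then have "card (common_set P j c) < card X"
      using X'(1) chosen_claimD(2) by (intro psubset_card_mono)
    then show False using min[OF loop_value.step[OF X \<open>card X > 1\<close> c]] by simp
  qed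
  then have "card X = 1" using X' by (metis One_nat_def Suc_lessI card_gt_0_iff)
  then show "\<exists>x. loop_value R tb n C P w j {x}" using X by (auto simp: card_1_singleton_iff)
next
  fix x y assume "loop_value R tb n C P w j {x}" "loop_value R tb n C P w j {y}"
  then have "({x}, {y}) \<in> (loop_step w j)\<^sup>* \<or> ({y}, {x}) \<in> (loop_step w j)\<^sup>*"
    unfolding loop_value_iff by (rule single_valued_confluent[OF single_valued_loop_step])
  then show "x = y" by (auto dest: loop_step_decreasing)
qed

text \<open>Values decrease along the run. If \<open>X\<close> comes after \<open>{x}\<close>, it is
  a nonempty subset of \<open>{x}\<close>.\<close>

lemma winner_in_loop_value:
  assumes "j \<in> {1..T}" "loop_value R tb n C P w j {x}" "loop_value R tb n C P w j X"
  shows "x \<in> X"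
proof -
  have "({x}, X) \<in> (loop_step w j)\<^sup>* \<or> (X, {x}) \<in> (loop_step w j)\<^sup>*"
    using assms(2,3) unfolding loop_value_iff
    by (rule single_valued_confluent[OF single_valued_loop_step])
  then show ?thesis using loop_value_props(2)[OF assms(3,1)] by (auto dest: loop_step_decreasing)
qed

abbreviation "W \<equiv> online_SCR R tb n C T P"

lemma loop_value_winner:
  assumes "j \<in> {1..T}"
  shows "loop_value R tb n C P W j {W j}"
  using theI'[OF loop_terminates[OF assms, of W]]
  by (simp add: online_SCR_round_winner[OF assms, of R tb n C P] round_winner_def)

lemma W_in: "W \<in> {1..T} \<rightarrow>\<^sub>E C"
  using loop_value_props(1)[OF loop_value_winner] by (auto simp: online_SCR_def PiE_iff)

section \<open>Charged claims\<close>

text \<open>Keeps exactly what the charging argument needs from the loop, without mentioning the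
  loop. Minimality of the common set expresses that no claim of priority at least \<open>q\<close>
  could have shrunk it further.\<close>

definition charged :: "real \<Rightarrow> nat \<Rightarrow> claim \<Rightarrow> bool" where
  "charged q j c \<longleftrightarrow> c \<in> claims R n C P j \<and> q \<le> priority P W j c \<and> W j \<in> common_set P j c \<and>
     (\<forall>c'\<in>claims R n C P j. q \<le> priority P W j c' \<longrightarrow> \<not> common_set P j c' \<subset> common_set P j c)"

text \<open>Take the smallest loop value that is the common set of a claim with priority at least
  \<open>q\<close>.\<close>

lemma charged_exists:
  assumes j: "j \<in> {1..T}" and c0: "c0 \<in> claims R n C P j" "q \<le> priority P W j c0"
  shows "\<exists>c. charged q j c"
proof -
  define Q where "Q X \<longleftrightarrow> loop_value R tb n C P W j X \<and>
    (\<exists>c\<in>claims R n C P j. q \<le> priority P W j c \<and> common_set P j c = X)" for X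
  \<comment> \<open>The greedy choice has at least the priority of any available claim, so the next
    value again satisfies \<open>Q\<close>.\<close>
  have next_Q: "\<exists>Y. Q Y \<and> card Y < card X"
    if X: "loop_value R tb n C P W j X"
      and c: "c \<in> claims R n C P j" "q \<le> priority P W j c" "common_set P j c \<subset> X" for X c
  proof -
    have fX: "finite X" using loop_value_props(1)[OF X j] finite_C finite_subset by blast
    have "finite (common_set P j c)" using fX c(3) finite_subset by blast
    then have "card (common_set P j c) > 0"
      using common_set_claim(2)[OF c(1) j] by (simp add: card_gt_0_iff)
    then have "card X > 1" using psubset_card_mono[OF fX c(3)] by simp
    moreover obtain c' where c': "chosen_claim R tb n C P W j X c'"
      using chosen_claim_exists[OF c(1,3)] by blast
    ultimately have "loop_value R tb n C P W j (common_set P j c')"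
      using loop_value.step[OF X] by blast
    then have "Q (common_set P j c')"
      using chosen_claimD(1)[OF c'] order_trans[OF c(2) chosen_claimD(3)[OF c' c(1,3)]]
      unfolding Q_def by blast
    then show ?thesis using psubset_card_mono[OF fX chosen_claimD(2)[OF c']] by blast
  qed
  have "\<exists>X. Q X"
  \<comment> \<open>A claim on all of \<open>C\<close> is never chosen by the loop, but the initial
    value \<open>C\<close> then satisfies \<open>Q\<close> itself.\<close>
  proof (cases "common_set P j c0 = C")
    case True
    then have "Q C" using c0 loop_value.init unfolding Q_def by blast
    then show ?thesis ..
  next
    case False
    then have "common_set P j c0 \<subset> C" using common_set_claim(1)[OF c0(1) j] by blast
    then show ?thesis using next_Q[OF loop_value.init c0] by blast
  qed
  then obtain X0 where "Q X0" ..
  from ex_has_least_nat[of Q, OF this, of card]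
  obtain X where X: "Q X" and min: "\<And>Y. Q Y \<Longrightarrow> card X \<le> card Y" by blast
  obtain c where c: "c \<in> claims R n C P j" "q \<le> priority P W j c" "common_set P j c = X"
    using X by (auto simp: Q_def)
  have "W j \<in> X" using winner_in_loop_value[OF j loop_value_winner[OF j]] X by (simp add: Q_def)
  moreover have "\<not> common_set P j c' \<subset> X"
    if c': "c' \<in> claims R n C P j" "q \<le> priority P W j c'" for c'
  proof
    assume "common_set P j c' \<subset> X"
    moreover have "loop_value R tb n C P W j X" using X by (simp add: Q_def)
    ultimately obtain Y where "Q Y" "card Y < card X" using next_Q[OF _ c'] by blast
    then show False using min[of Y] by simp
  qed
  ultimately have "charged q j c" using c unfolding charged_def by blast
  then show ?thesis ..
qed

text \<open>Extending \<open>S\<close> to a maximal group keeps its common sets, hence its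
  representation, and can only raise its size.\<close>

lemma claim_of_large_group:
  assumes "j \<in> {1..T}" "S \<noteq> {}" "S \<subseteq> {1..n}" "r \<in> R (card C) k" "j \<le> k" "agree P k r S"
    and "q * (real (rep P W j (S, r)) + 1) \<le> real (card S)"
  obtains c where "c \<in> claims R n C P j" "q \<le> priority P W j c"
    "common_set P j c = common_set P j (S, r)"
proof -
  have "agree P j r S" using agree_antimono[OF assms(6,5)] .
  then obtain S' where S': "S \<subseteq> S'" "(S', restrict r {1..j}) \<in> claims R n C P j"
    "\<forall>t\<in>{1..j}. common_set P t (S', restrict r {1..j}) = common_set P t (S, r)"
    using extend_to_claim[OF assms(2,3) R_restrict[OF assms(4,5)]] by blast
  have "common_set P t (S', restrict r {1..j}) = common_set P t (S, r)" if "t \<in> {1..<j}" for t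
    using S'(3) that by simp
  then have "rep P W j (S', restrict r {1..j}) = rep P W j (S, r)"
    unfolding rep_def by (intro arg_cong[of _ _ card] Collect_cong) (metis (no_types))
  moreover have "card S \<le> card S'" using S'(1) claimsD(3)[OF S'(2)]
    by (meson card_mono finite_atLeastAtMost finite_subset)
  ultimately have "q * (real (rep P W j (S', restrict r {1..j})) + 1) \<le> real (card S')"
    using assms(7) by simp
  then have "q \<le> priority P W j (S', restrict r {1..j})"
    by (simp add: priority_def pos_le_divide_eq add.commute)
  then show thesis using that[OF S'(2)] S'(3) assms(1) by simp
qed

text \<open>A shared voter makes both common sets top sets of one ranking, hence nested. Minimality
  of the charged one puts it inside that of \<open>S\<close>, and the winner with it.\<close>

lemma charged_meets:
  assumes ch: "charged q j c" and j: "j \<in> {1..T}"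
    and S: "S \<subseteq> {1..n}" "r \<in> R (card C) k" "j \<le> k" "agree P k r S"
    and large: "q * (real (rep P W j (S, r)) + 1) \<le> real (card S)"
    and meets: "fst c \<inter> S \<noteq> {}"
  shows "W j \<in> common_set P j (S, r)"
proof -
  obtain S1 r1 where c: "c = (S1, r1)" by force
  obtain i where i: "i \<in> S1" "i \<in> S" using meets c by auto
  have "S \<noteq> {}" using i by blast
  from claim_of_large_group[OF j this S large]
  obtain c' where c': "c' \<in> claims R n C P j" "q \<le> priority P W j c'"
    "common_set P j c' = common_set P j (S, r)" .
  have "(S1, r1) \<in> claims R n C P j" using ch c by (simp add: charged_def)
  then have "common_set P j c = top_set P i j (r1 j)"
    using common_set_eq[OF claimsD(4) i(1), of r1 j j] j c by simp
  moreover have "common_set P j (S, r) = top_set P i j (r j)"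
    using common_set_eq[OF S(4) i(2), of j] j S(3) by simp
  moreover have "\<not> common_set P j (S, r) \<subset> common_set P j c" "W j \<in> common_set P j c"
    using ch c'(1,2) unfolding charged_def c'(3)[symmetric] by blast+
  ultimately show ?thesis
    using top_set_mono[of "r j" "r1 j" P i j] top_set_mono[of "r1 j" "r j" P i j] linear[of "r j" "r1 j"]
    by (metis psubsetI subsetD)
qed

section \<open>Proportional representation\<close>

lemma rep_mono: "s \<le> t \<Longrightarrow> rep P w s c \<le> rep P w t c"
  unfolding rep_def by (intro card_mono) auto

text \<open>The intersection has as many elements as each of the finite top sets that contain it, so
  it equals all of them.\<close>

lemma solid_agree:
  assumes "S \<subseteq> {1..n}" "r \<in> R (card C) T" "\<And>j. j \<in> {1..T} \<Longrightarrow> solid P S r j"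
  shows "agree P T r S"
proof -
  have "(\<Inter>i\<in>S. top_set P i j (r j)) = top_set P i' j (r j)" if "i' \<in> S" "j \<in> {1..T}" for i' j
  proof (rule card_subset_eq)
    have ct: "card (top_set P i' j (r j)) = r j"
      using card_top_set(1)[of i' j "r j"] rank_bounds[OF assms(2) that(2)] assms(1) that by auto
    then show "card (\<Inter>i\<in>S. top_set P i j (r j)) = card (top_set P i' j (r j))"
      using assms(3)[OF that(2)] by (simp add: solid_def)
    show "finite (top_set P i' j (r j))" by (simp add: top_set_def)
  qed (use that in blast)
  then show ?thesis unfolding agree_def by metis
qed

text \<open>As \<open>rep\<close> counts strictly earlier rounds, its value at \<open>Suc T\<close>
  covers the whole horizon.\<close>

lemma proportional_representation:
  assumes S: "S \<noteq> {}" "S \<subseteq> {1..n}" "r \<in> R (card C) T" "agree P T r S"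
    and l: "1 \<le> l" "real l * real n / real T \<le> real (card S)"
  shows "l \<le> rep P W (Suc T) (S, r)"
proof (rule ccontr)
  assume "\<not> ?thesis"
  then have "real (rep P W (Suc T) (S, r)) + 1 \<le> real l" by simp
  define q where "q = real n / real T"
  have q: "q > 0" using n_pos T_pos by (simp add: q_def)
  have "q * (real (rep P W (Suc T) (S, r)) + 1) \<le> q * real l"
    using q \<open>_ \<le> real l\<close> by (intro mult_left_mono) auto
  then have big: "q * (real (rep P W (Suc T) (S, r)) + 1) \<le> real (card S)"
    using l(2) by (simp add: q_def mult.commute)
  \<comment> \<open>\<open>rep\<close> only grows, so the threshold that \<open>S\<close> meets
    after the last round was met in every round.\<close>
  have large: "q * (real (rep P W j (S, r)) + 1) \<le> real (card S)" if "j \<le> Suc T" for j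
  proof -
    have "q * (real (rep P W j (S, r)) + 1) \<le> q * (real (rep P W (Suc T) (S, r)) + 1)"
      using q rep_mono[OF that] by (intro mult_left_mono) auto
    then show ?thesis using big by linarith
  qed
  have "\<exists>c. charged q t c" if t: "t \<in> {1..T}" for t
  proof -
    have "t \<le> T" "t \<le> Suc T" using t by auto
    from claim_of_large_group[OF t S(1-3) this(1) S(4) large[OF this(2)]]
    show ?thesis using charged_exists[OF t] by metis
  qed
  then obtain c where c: "\<And>t. t \<in> {1..T} \<Longrightarrow> charged q t (c t)" by metis
  have "real T * q + q \<le> real (card {1..n})"
  proof (rule charging_leftover[where G = "\<lambda>t. fst (c t)" and S = S])
    fix t assume t: "t \<in> {1..T}"
    obtain S1 r1 where ct: "c t = (S1, r1)" by force
    have cl: "(S1, r1) \<in> claims R n C P t" using c[OF t] ct by (simp add: charged_def)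
    note D = claimsD[OF cl]
    show "fst (c t) \<subseteq> {1..n}" using D ct by simp
    have pr: "q * (real (rep P W t (S1, r1)) + 1) \<le> real (card S1)"
      using c[OF t] ct by (simp add: charged_def priority_def field_simps)
    \<comment> \<open>The claim charged in round \<open>t\<close> met the threshold in round
      \<open>s\<close> too, so every earlier charge to one of its members gave it a represented
      round.\<close>
    have "W s \<in> common_set P s (S1, r1)"
      if s: "s \<in> {1..<t}" and meets: "fst (c s) \<inter> fst (c t) \<noteq> {}" for s
    proof (rule charged_meets[OF c _ D(3,1) _ D(4)])
      show "q * (real (rep P W s (S1, r1)) + 1) \<le> real (card S1)"
      proof -
        have "q * (real (rep P W s (S1, r1)) + 1) \<le> q * (real (rep P W t (S1, r1)) + 1)"
          using q rep_mono[of s t] s by (intro mult_left_mono) auto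
        then show ?thesis using pr by linarith
      qed
    qed (use s t meets ct in auto)
    then have "card {s\<in>{1..<t}. fst (c s) \<inter> fst (c t) \<noteq> {}} \<le> rep P W t (S1, r1)"
      unfolding rep_def by (intro card_mono) auto
    then have "q * (real (card {s\<in>{1..<t}. fst (c s) \<inter> fst (c t) \<noteq> {}}) + 1)
        \<le> q * (real (rep P W t (S1, r1)) + 1)"
      using q by (intro mult_left_mono) auto
    then show "q * (real (card {s\<in>{1..<t}. fst (c s) \<inter> fst (c t) \<noteq> {}}) + 1)
        \<le> real (card (fst (c t)))" using pr ct by simp
  next
    have "W s \<in> common_set P s (S, r)" if "s \<in> {1..T}" "fst (c s) \<inter> S \<noteq> {}" for s
      by (rule charged_meets[OF c _ S(2,3) _ S(4) large]) (use that in auto)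
    then have "card {t\<in>{1..T}. fst (c t) \<inter> S \<noteq> {}} \<le> rep P W (Suc T) (S, r)"
      unfolding rep_def by (intro card_mono) auto
    then have "q * (real (card {t\<in>{1..T}. fst (c t) \<inter> S \<noteq> {}}) + 1)
        \<le> q * (real (rep P W (Suc T) (S, r)) + 1)"
      using q by (intro mult_left_mono) auto
    then show "q * (real (card {t\<in>{1..T}. fst (c t) \<inter> S \<noteq> {}}) + 1) \<le> real (card S)"
      using big by linarith
  qed (use q S in auto)
  \<comment> \<open>Here \<open>T\<close> times \<open>q\<close> is \<open>n\<close>, which leaves
    no room for the extra \<open>q\<close>.\<close>
  then show False using q T_pos by (simp add: q_def)
qed

lemma wPSC_for_W: "wPSC_for (R (card C) T) n T P W"
  unfolding wPSC_for_def
proof (intro ballI allI impI, elim conjE)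
  fix r l S
  assume r: "r \<in> R (card C) T" and l: "1 \<le> (l::nat)" and S: "is_group n S"
    and solid: "\<forall>j\<in>{1..T}. solid P S r j" and big: "real l * real n / real T \<le> real (card S)"
  have S': "S \<noteq> {}" "S \<subseteq> {1..n}" using S by (auto simp: is_group_def)
  have ag: "agree P T r S" using solid_agree[OF S'(2) r] solid by blast
  \<comment> \<open>The axiom uses unions and \<open>rep\<close> uses intersections; for an agreeing
    group they coincide.\<close>
  have un: "(\<Union>i\<in>S. top_set P i j (r j)) = common_set P j (S, r)" if "j \<in> {1..T}" for j
    by (rule SUP_eq_const[OF S'(1)]) (use common_set_eq[OF ag _ that] in simp)
  then have "rep P W (Suc T) (S, r) = card {j\<in>{1..T}. W j \<in> (\<Union>i\<in>S. top_set P i j (r j))}"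
    unfolding rep_def atLeastLessThanSuc_atLeastAtMost
    by (intro arg_cong[of _ _ card] Collect_cong) (metis (no_types))
  then show "l \<le> card {j\<in>{1..T}. W j \<in> (\<Union>i\<in>S. top_set P i j (r j))}"
    using proportional_representation[OF S' r ag l big] by simp
qed

end

section \<open>The two families of rank vectors\<close>

lemma SCR_rank_vectors:
  assumes "\<And>n C j. linear_order (tb n C j)" "is_input n C T P"
  shows "SCR rank_vectors tb n C T P"
proof
  fix r m j s assume "r \<in> rank_vectors m j" "s \<le> j"
  then show "restrict r {1..s} \<in> rank_vectors m s" by (auto simp: rank_vectors_def)
qed (use assms in \<open>auto simp: rank_vectors_def\<close>)

lemma SCR_fixed_rank_vectors:
  assumes "\<And>n C j. linear_order (tb n C j)" "is_input n C T P"
  shows "SCR fixed_rank_vectors tb n C T P"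
proof
  fix r m j s assume r: "r \<in> fixed_rank_vectors m j" and "s \<le> j"
  then obtain k where k: "r = (\<lambda>t\<in>{1..j}. k)" "k \<in> {1..m}" by (auto simp: fixed_rank_vectors_def)
  have "restrict r {1..s} = (\<lambda>t\<in>{1..s}. k)" using \<open>s \<le> j\<close> k by (auto simp: fun_eq_iff)
  then show "restrict r {1..s} \<in> fixed_rank_vectors m s" using k by (auto simp: fixed_rank_vectors_def)
qed (use assms in \<open>auto simp: fixed_rank_vectors_def rank_vectors_def\<close>)

theorem theorem4p7:
  fixes tb :: "'c tie_break"
  assumes "\<And>n C j. linear_order (tb n C j)"
  shows "(SCR_well_defined fixed_rank_vectors tb \<and>
          is_rule (online_SCR fixed_rank_vectors tb) \<and>
          online (online_SCR fixed_rank_vectors tb) \<and>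
          satisfies (online_SCR fixed_rank_vectors tb) fixed_rank_wPSC) \<and>
         (SCR_well_defined rank_vectors tb \<and>
          is_rule (online_SCR rank_vectors tb) \<and>
          online (online_SCR rank_vectors tb) \<and>
          satisfies (online_SCR rank_vectors tb) rank_wPSC)"
proof -
  \<comment> \<open>Exports the locale results for any family that satisfies \<open>SCR\<close> on
    all inputs, so that both families are treated at once.\<close>
  have SCR_props: "SCR_well_defined R tb" "is_rule (online_SCR R tb)"
    "\<And>n C T P. is_input n C T P \<Longrightarrow> wPSC_for (R (card C) T) n T P (online_SCR R tb n C T P)"
    if "\<And>n C T P. is_input n C T P \<Longrightarrow> SCR R tb n C T P" for R
    unfolding SCR_well_defined_def is_rule_def
    by (intro allI impI ballI SCR.loop_terminates SCR.W_in SCR.wPSC_for_W that; assumption)+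
  show ?thesis
    unfolding satisfies_def fixed_rank_wPSC_def rank_wPSC_def
    by (intro conjI allI impI online_online_SCR SCR_props;
        (rule SCR_fixed_rank_vectors[OF assms] SCR_rank_vectors[OF assms])?; assumption)
qed

end
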